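(* Let $Y$ be a quasi-Polish space and let $X\subseteq Y$ be countable (with the subspace topology). The following are equivalent: (1) $X\in\mathbf{\Delta}^0_3(Y)$; (2) every non-empty $A\in\mathbf{\Pi}^0_2(X)$ contains a finite non-empty $F\in\mathbf{\Delta}^0_2(A)$; (3) for every non-empty $A\subseteq X$ there is $x\in A$ such that $\{x\}$ is locally closed in $A$. Here subsets $A$ of $X$ carry the subspace topology.
   Context: For a topological space $X$, define $\mathbf{\Sigma}^0_1(X)$ to be the set of open subsets of $X$, and for a countable ordinal $\alpha>1$ let $\mathbf{\Sigma}^0_\alpha(X)$ be the set of all $A\subseteq X$ of the form $A=\bigcup_{i\in\omega}B_i\setminus B_i'$ where for each $i$, $B_i,B_i'\in\mathbf{\Sigma}^0_{\beta_i}(X)$ for some $\beta_i<\alpha$. Let $\mathbf{\Pi}^0_\alpha(X)=\{X\setminus A : A\in\mathbf{\Sigma}^0_\alpha(X)\}$ and $\mathbf{\Delta}^0_\alpha(X)=\mathbf{\Sigma}^0_\alpha(X)\cap\mathbf{\Pi}^0_\alpha(X)$. A space is quasi-Polish if it is countably based (second countable) and its topology is induced by a Smyth-complete quasi-metric; equivalently (a known characterization, usable as the definition), if it is homeomorphic to a $\mathbf{\Pi}^0_2$-subset of $\mathcal{P}(\omega)$, the power set of $\omega$ with the Scott topology (basis: the sets $\{A\subseteq\omega : F\subseteq A\}$, $F$ finite). A subset is locally closed if it is the intersection of an open set with a closed set. *)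

theory Defs
  imports "HOL-Analysis.Abstract_Topology" "HOL-Library.Countable_Set"
begin

text \<open>
  The Borel hierarchy of an arbitrary (not necessarily metrizable) topological space, at the
  finite levels \<open>1, 2, 3, \<dots>\<close>. Differences are used rather than complements because open sets
  need not be \<open>F\<^sub>\<sigma>\<close> here. No set has level \<open>0\<close>, so the levels \<open>\<beta> i\<close> below are automatically
  at least \<open>1\<close>.
\<close>

inductive is_Sigma0 :: "'a topology \<Rightarrow> nat \<Rightarrow> 'a set \<Rightarrow> bool" for X where
  opens: "openin X U \<Longrightarrow> is_Sigma0 X 1 U"
| union_diff: "\<lbrakk>1 < \<alpha>; \<And>i::nat. \<beta> i < \<alpha>;
      \<And>i. is_Sigma0 X (\<beta> i) (B i); \<And>i. is_Sigma0 X (\<beta> i) (B' i)\<rbrakk>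
    \<Longrightarrow> is_Sigma0 X \<alpha> (\<Union>i. B i - B' i)"

definition Sigma0 :: "nat \<Rightarrow> 'a topology \<Rightarrow> 'a set set" where
  "Sigma0 \<alpha> X = {A. is_Sigma0 X \<alpha> A}"

definition Pi0 :: "nat \<Rightarrow> 'a topology \<Rightarrow> 'a set set" where
  "Pi0 \<alpha> X = {topspace X - A | A. A \<in> Sigma0 \<alpha> X}"

definition Delta0 :: "nat \<Rightarrow> 'a topology \<Rightarrow> 'a set set" where
  "Delta0 \<alpha> X = Sigma0 \<alpha> X \<inter> Pi0 \<alpha> X"

text \<open>
  The Scott topology on \<open>\<P>(\<omega>)\<close>. The generating family covers the space and is closed under
  binary intersections, so it is a basis and not merely a subbasis.
\<close>

definition scott_Pomega :: "nat set topology" where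
  "scott_Pomega = topology_generated_by {{A. F \<subseteq> A} | F. finite F}"

text \<open>
  Quasi-Polish spaces, through their characterization as the spaces homeomorphic to a
  \<open>\<Pi>\<^sup>0\<^sub>2\<close>-subset of \<open>\<P>(\<omega>)\<close>; this is equivalent to being second countable with topology induced
  by a Smyth-complete quasi-metric.
\<close>

definition quasi_Polish :: "'a topology \<Rightarrow> bool" where
  "quasi_Polish Y \<longleftrightarrow>
     (\<exists>S \<in> Pi0 2 scott_Pomega. Y homeomorphic_space subtopology scott_Pomega S)"

definition locally_closedin :: "'a topology \<Rightarrow> 'a set \<Rightarrow> bool" where
  "locally_closedin X S \<longleftrightarrow> (\<exists>U C. openin X U \<and> closedin X C \<and> S = U \<inter> C)"

end

theory Submission
  imports Defs
begin

text \<open>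
  Condition (3) says that no non-empty subset of \<open>X\<close> is dense-in-itself for the topology generated
  by the open and the closed sets.

  (3) implies (1): call \<open>P \<subseteq> X\<close> good if some \<open>\<Sigma>\<^sup>0\<^sub>2\<close> set \<open>W\<close> has trace \<open>P\<close> on \<open>X\<close> and \<open>W - P\<close> is
  \<open>\<Sigma>\<^sup>0\<^sub>3\<close>. Good sets are closed under countable unions, so there is a largest one \<open>M\<close>. If \<open>V\<close> is
  locally closed with \<open>V \<inter> (X - M) = {x}\<close>, then \<open>W \<union> V\<close> shows that \<open>M \<union> {x}\<close> is good; hence
  \<open>M = X\<close>, and \<open>X\<close> is \<open>\<Pi>\<^sup>0\<^sub>3\<close>.

  (1) implies (3): in \<open>\<P>(\<omega>)\<close>, write \<open>X = \<Inter>\<^sub>i H\<^sub>i\<close> with \<open>H\<^sub>i\<close> in \<open>\<Sigma>\<^sup>0\<^sub>2\<close>. If \<open>A \<subseteq> X\<close> has no locally closed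
  point, a Baire category construction yields locally closed sets \<open>L\<^sub>0 \<supseteq> L\<^sub>1 \<supseteq> \<dots>\<close> meeting \<open>A\<close>,
  with \<open>L\<^sub>i\<^sub>+\<^sub>1 \<subseteq> H\<^sub>i\<close> avoiding the \<open>i\<close>-th point of \<open>X\<close>, and a common point of them.

  (2) and (3) are equivalent since a finite locally closed set in a \<open>T\<^sub>0\<close> space contains a locally
  closed point, and since the closure in \<open>X\<close> of any subset for the finer topology above is
  \<open>\<Pi>\<^sup>0\<^sub>2\<close>, \<open>X\<close> being countable.
\<close>

section \<open>Closure properties of the Borel classes at finite levels\<close>

lemma is_Sigma0_UN_diff:
  assumes "countable I" "1 < \<alpha>" "\<And>i. i \<in> I \<Longrightarrow> \<beta> i < \<alpha>"
    and "\<And>i. i \<in> I \<Longrightarrow> is_Sigma0 T (\<beta> i) (B i)"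
    and "\<And>i. i \<in> I \<Longrightarrow> is_Sigma0 T (\<beta> i) (B' i)"
  shows "is_Sigma0 T \<alpha> (\<Union>i\<in>I. B i - B' i)"
proof (cases "I = {}")
  case True
  \<comment> \<open>The sequence \<open>from_nat_into I\<close> need not stay inside an empty
    \<open>I\<close>, so the empty union is built from empty differences of level 1.\<close>
  have "is_Sigma0 T \<alpha> (\<Union>i::nat. {} - {})"
    by (rule union_diff[where \<beta> = "\<lambda>_. 1"]) (use assms(2) opens[of T "{}"] in auto)
  then show ?thesis using True by simp
next
  case False
  let ?g = "from_nat_into I"
  have g: "?g n \<in> I" for n using False by (rule from_nat_into)
  have "is_Sigma0 T \<alpha> (\<Union>n. B (?g n) - B' (?g n))"
    by (rule union_diff[where \<beta> = "\<lambda>n. \<beta> (?g n)"]) (use assms g in auto)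
  moreover have "(\<Union>n. B (?g n) - B' (?g n)) = (\<Union>i\<in>range ?g. B i - B' i)" by auto
  ultimately show ?thesis using range_from_nat_into[OF False assms(1)] by simp
qed

lemma is_Sigma0_imp_UN_diff:
  assumes "is_Sigma0 T \<alpha> A" "1 < \<alpha>"
  shows "\<exists>\<beta> B B'. (\<forall>i::nat. \<beta> i < \<alpha> \<and> is_Sigma0 T (\<beta> i) (B i) \<and> is_Sigma0 T (\<beta> i) (B' i)) \<and>
    A = (\<Union>i. B i - B' i)"
  using assms(1)
proof (cases rule: is_Sigma0.cases)
  case opens
  then show ?thesis using assms(2) by simp
next
  case (union_diff \<beta> B B')
  then show ?thesis by (intro exI[of _ \<beta>] exI[of _ B] exI[of _ B']) simp
qed

text \<open>A representation is chosen for every member of the family; the pairs of an index in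
  \<open>I\<close> and a natural number then index all differences, and there are countably
  many.\<close>

lemma is_Sigma0_UN:
  assumes "countable I" "1 < \<alpha>" "\<And>i. i \<in> I \<Longrightarrow> is_Sigma0 T \<alpha> (A i)"
  shows "is_Sigma0 T \<alpha> (\<Union>i\<in>I. A i)"
proof -
  define Q where "Q i \<beta> B B' \<longleftrightarrow> (\<forall>j::nat. \<beta> j < \<alpha> \<and> is_Sigma0 T (\<beta> j) (B j) \<and> is_Sigma0 T (\<beta> j) (B' j)) \<and>
    A i = (\<Union>j. B j - B' j)" for i \<beta> B B'
  have "\<exists>\<beta> B B'. Q i \<beta> B B'" if "i \<in> I" for i
    unfolding Q_def using is_Sigma0_imp_UN_diff[OF assms(3)[OF that] assms(2)] .
  then obtain \<beta> B B' where Q: "\<And>i. i \<in> I \<Longrightarrow> Q i (\<beta> i) (B i) (B' i)" by metis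
  have *: "\<beta> i j < \<alpha>" "is_Sigma0 T (\<beta> i j) (B i j)" "is_Sigma0 T (\<beta> i j) (B' i j)" if "i \<in> I" for i j
    using Q[OF that] unfolding Q_def by auto
  have A: "A i = (\<Union>j. B i j - B' i j)" if "i \<in> I" for i
    using Q[OF that] unfolding Q_def by auto
  have "is_Sigma0 T \<alpha> (\<Union>p\<in>I \<times> UNIV. B (fst p) (snd p) - B' (fst p) (snd p))"
    by (rule is_Sigma0_UN_diff[where \<beta> = "\<lambda>p. \<beta> (fst p) (snd p)"]) (use assms * in auto)
  moreover have "(\<Union>p\<in>I \<times> UNIV. B (fst p) (snd p) - B' (fst p) (snd p)) = (\<Union>i\<in>I. A i)"
    by (auto simp: A) blast
  ultimately show ?thesis by simp
qed

lemma is_Sigma0_Un: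
  assumes "1 < \<alpha>" "is_Sigma0 T \<alpha> A" "is_Sigma0 T \<alpha> B"
  shows "is_Sigma0 T \<alpha> (A \<union> B)"
proof -
  have "is_Sigma0 T \<alpha> (\<Union>b\<in>UNIV. if b then A else B)"
    by (rule is_Sigma0_UN) (use assms in auto)
  then show ?thesis by (simp add: UNIV_bool Un_commute)
qed

lemma is_Sigma0_diff:
  assumes "\<beta> < \<alpha>" "1 < \<alpha>" "is_Sigma0 T \<beta> A" "is_Sigma0 T \<beta> B"
  shows "is_Sigma0 T \<alpha> (A - B)"
  using is_Sigma0_UN_diff[of "{()}" \<alpha> "\<lambda>_. \<beta>" T "\<lambda>_. A" "\<lambda>_. B"] assms by simp

lemma is_Sigma0_level: "is_Sigma0 T \<alpha> A \<Longrightarrow> 1 \<le> \<alpha>"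
  by (induction rule: is_Sigma0.induct) auto

lemma is_Sigma0_1_iff: "is_Sigma0 T (Suc 0) A \<longleftrightarrow> openin T A"
proof
  show "is_Sigma0 T (Suc 0) A \<Longrightarrow> openin T A" by (cases rule: is_Sigma0.cases) auto
qed (use opens[of T A] in simp)

lemma is_Sigma0_subset: "is_Sigma0 T \<alpha> A \<Longrightarrow> A \<subseteq> topspace T"
  by (induction rule: is_Sigma0.induct) (auto dest: openin_subset)

text \<open>From \<open>A = A - {}\<close>. The two sides of a difference share one level, so the
  empty set is first placed at level \<open>\<alpha>\<close>.\<close>

lemma is_Sigma0_mono:
  assumes "is_Sigma0 T \<alpha> A" "\<alpha> \<le> \<gamma>" shows "is_Sigma0 T \<gamma> A"
proof (cases "\<alpha> = \<gamma>")
  case False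
  have "is_Sigma0 T \<alpha> {}"
  proof (cases "\<alpha> = 1")
    case True
    then show ?thesis using opens[of T "{}"] by simp
  next
    case False
    then have "1 < \<alpha>" using is_Sigma0_level[OF assms(1)] by simp
    then show ?thesis using is_Sigma0_UN[of "{}" \<alpha> T] by simp
  qed
  then have "is_Sigma0 T \<gamma> (A - {})"
    by (intro is_Sigma0_diff[of \<alpha>]) (use assms False is_Sigma0_level[OF assms(1)] in auto)
  then show ?thesis by simp
qed (use assms in simp)

lemma is_Sigma0_2_imp_UN_diff_open:
  assumes "is_Sigma0 T 2 A"
  shows "\<exists>U U'. (\<forall>i::nat. openin T (U i) \<and> openin T (U' i)) \<and> A = (\<Union>i. U i - U' i)"
proof -
  obtain \<beta> B B' where *: "\<forall>i::nat. \<beta> i < 2 \<and> is_Sigma0 T (\<beta> i) (B i) \<and> is_Sigma0 T (\<beta> i) (B' i)"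
    "A = (\<Union>i. B i - B' i)"
    using is_Sigma0_imp_UN_diff[OF assms] by auto
  \<comment> \<open>Levels start at 1, so a level below 2 is exactly 1 and its sets are
    open.\<close>
  have "\<beta> i = Suc 0" for i
    using *(1) is_Sigma0_level[of T "\<beta> i" "B i"] by (metis One_nat_def le_antisym less_2_cases_iff not_one_le_zero)
  with * show ?thesis by (intro exI[of _ B] exI[of _ B']) (simp add: is_Sigma0_1_iff)
qed

lemma is_Sigma0_3_imp_UN_diff:
  assumes "is_Sigma0 T 3 A"
  shows "\<exists>B B'. (\<forall>i::nat. is_Sigma0 T 2 (B i) \<and> is_Sigma0 T 2 (B' i)) \<and> A = (\<Union>i. B i - B' i)"
proof -
  obtain \<beta> B B' where *: "\<forall>i::nat. \<beta> i < 3 \<and> is_Sigma0 T (\<beta> i) (B i) \<and> is_Sigma0 T (\<beta> i) (B' i)"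
    "A = (\<Union>i. B i - B' i)"
    using is_Sigma0_imp_UN_diff[OF assms] by auto
  have "is_Sigma0 T 2 (B i) \<and> is_Sigma0 T 2 (B' i)" for i
  proof -
    have "\<beta> i \<le> 2" using *(1)[rule_format, of i] by simp
    then show ?thesis using *(1) is_Sigma0_mono by blast
  qed
  with * show ?thesis by blast
qed

lemma is_Sigma0_2_diff_open: "openin T U \<Longrightarrow> openin T U' \<Longrightarrow> is_Sigma0 T 2 (U - U')"
  by (rule is_Sigma0_diff[of "Suc 0"]) (auto simp: is_Sigma0_1_iff)

text \<open>Differences of open sets are closed under intersection: \<open>(V - V') \<inter> (U -
  U') = (V \<inter> U) - (V' \<union> U')\<close>.\<close>

lemma is_Sigma0_2_Int_diff_open:
  assumes "is_Sigma0 T 2 A" "openin T U" "openin T U'"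
  shows "is_Sigma0 T 2 (A \<inter> (U - U'))"
proof -
  obtain V V' where *: "\<forall>i::nat. openin T (V i) \<and> openin T (V' i)" "A = (\<Union>i. V i - V' i)"
    using is_Sigma0_2_imp_UN_diff_open[OF assms(1)] by auto
  have "is_Sigma0 T 2 ((V i \<inter> U) - (V' i \<union> U'))" for i
    using * assms by (intro is_Sigma0_2_diff_open openin_Int openin_Un) auto
  then have "is_Sigma0 T 2 (\<Union>i. (V i \<inter> U) - (V' i \<union> U'))"
    by (intro is_Sigma0_UN) simp_all
  moreover have "(\<Union>i. (V i \<inter> U) - (V' i \<union> U')) = A \<inter> (U - U')" using * by auto
  ultimately show ?thesis by simp
qed

section \<open>Normal forms for \<open>Pi0 2\<close> and \<open>Pi0 3\<close>\<close>

lemma Pi0_iff: "A \<in> Pi0 \<alpha> T \<longleftrightarrow> A \<subseteq> topspace T \<and> is_Sigma0 T \<alpha> (topspace T - A)"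
proof
  assume "A \<in> Pi0 \<alpha> T"
  then show "A \<subseteq> topspace T \<and> is_Sigma0 T \<alpha> (topspace T - A)"
    using is_Sigma0_subset[of T \<alpha>] by (auto simp: Pi0_def Sigma0_def double_diff)
next
  assume "A \<subseteq> topspace T \<and> is_Sigma0 T \<alpha> (topspace T - A)"
  moreover from this have "A = topspace T - (topspace T - A)" by auto
  ultimately show "A \<in> Pi0 \<alpha> T" unfolding Pi0_def Sigma0_def by blast
qed

lemma Pi0_2_eq_INT:
  assumes "A \<in> Pi0 2 T"
  shows "\<exists>U U'. (\<forall>i j::nat. openin T (U i j) \<and> openin T (U' i j)) \<and>
    A = topspace T \<inter> (\<Inter>i::nat. \<Union>j. U i j - U' i j)"
proof -
  obtain V V' where *: "\<And>i::nat. openin T (V i)" "\<And>i. openin T (V' i)"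
      "topspace T - A = (\<Union>i. V i - V' i)"
    using assms is_Sigma0_2_imp_UN_diff_open[of T "topspace T - A"] unfolding Pi0_iff by blast
  \<comment> \<open>The complement of \<open>V i - V' i\<close> splits into \<open>V' i\<close>,
    stored at \<open>j = 0\<close>, and the complement of \<open>V i\<close>, repeated at every
    other \<open>j\<close>.\<close>
  let ?U = "\<lambda>(i::nat) j::nat. if j = 0 then V' i else topspace T"
  let ?U' = "\<lambda>(i::nat) j::nat. if j = 0 then {} else V i"
  have S: "(\<Union>j. ?U i j - ?U' i j) = V' i \<union> (topspace T - V i)" for i
    by (auto split: if_splits)
  have "A = topspace T - (\<Union>i. V i - V' i)"
    using assms *(3) by (auto simp: Pi0_iff)
  also have "\<dots> = topspace T \<inter> (\<Inter>i. \<Union>j. ?U i j - ?U' i j)"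
    unfolding S using openin_subset[OF *(2)] by auto
  finally show ?thesis using * by (intro exI[of _ ?U] exI[of _ ?U'] conjI) auto
qed

text \<open>With \<open>B i\<close> split into the pieces \<open>V i k - V' i k\<close>, the
  complement of a piece minus \<open>B' i\<close> is \<open>?H i k\<close>, a union of two
  differences of open sets and the \<open>\<Sigma>\<^sup>0\<^sub>2\<close> set \<open>B' i\<close>.
  Intersecting over all pairs \<open>(i, k)\<close> gives the form already available for
  \<open>Pi0 2\<close>.\<close>

lemma Pi0_3_eq_INT:
  assumes "A \<in> Pi0 3 T"
  shows "\<exists>U U'. (\<forall>i j::nat. openin T (U i j) \<and> openin T (U' i j)) \<and>
    A = topspace T \<inter> (\<Inter>i::nat. \<Union>j. U i j - U' i j)"
proof -
  obtain B B' where B: "\<And>i::nat. is_Sigma0 T 2 (B i)" "\<And>i. is_Sigma0 T 2 (B' i)"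
      "topspace T - A = (\<Union>i. B i - B' i)"
    using assms is_Sigma0_3_imp_UN_diff[of T "topspace T - A"] unfolding Pi0_iff by blast
  define Q where "Q C V V' \<longleftrightarrow> (\<forall>i::nat. openin T (V i) \<and> openin T (V' i)) \<and> C = (\<Union>i. V i - V' i)"
    for C V V'
  have ex: "\<exists>V V'. Q C V V'" if "is_Sigma0 T 2 C" for C
    unfolding Q_def using is_Sigma0_2_imp_UN_diff_open[OF that] .
  obtain V V' where "\<And>i. Q (B i) (V i) (V' i)" using ex[OF B(1)] by metis
  then have V: "\<And>i j. openin T (V i j)" "\<And>i j. openin T (V' i j)" "\<And>i. B i = (\<Union>j. V i j - V' i j)"
    unfolding Q_def by auto
  obtain W W' where "\<And>i. Q (B' i) (W i) (W' i)" using ex[OF B(2)] by metis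
  then have W: "\<And>i j. openin T (W i j)" "\<And>i j. openin T (W' i j)" "\<And>i. B' i = (\<Union>j. W i j - W' i j)"
    unfolding Q_def by auto
  define h where "h n = prod_decode n" for n
  let ?H = "\<lambda>i k. (topspace T - V i k) \<union> (V' i k \<union> B' i)"
  \<comment> \<open>Slots 0 and 1 hold the complement of \<open>V i k\<close> and the set
    \<open>V' i k\<close>; from slot 2 on come the differences that make up \<open>B' i\<close>,
    shifted by 2.\<close>
  let ?U = "\<lambda>n j. if j = 0 then topspace T else if j = 1 then V' (fst (h n)) (snd (h n))
      else W (fst (h n)) (j - 2)"
  let ?U' = "\<lambda>n j. if j = 0 then V (fst (h n)) (snd (h n)) else if j = 1 then {}
      else W' (fst (h n)) (j - 2)"
  have S: "(\<Union>j. ?U n j - ?U' n j) = ?H (fst (h n)) (snd (h n))" for n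
  proof -
    have "(UNIV::nat set) = insert 0 (insert 1 (range (\<lambda>j. j + 2)))"
    proof -
      have "j \<in> insert 0 (insert 1 (range (\<lambda>j. j + 2)))" for j :: nat
        by (cases "j < 2") (auto simp: less_2_cases_iff intro!: image_eqI[of _ _ "j - 2"])
      then show ?thesis by blast
    qed
    then have "(\<Union>j. ?U n j - ?U' n j) = (\<Union>j\<in>insert 0 (insert 1 (range (\<lambda>j. j + 2))). ?U n j - ?U' n j)"
      by (rule SUP_cong) simp
    also have "\<dots> = ?H (fst (h n)) (snd (h n))" by (simp add: W(3))
    finally show ?thesis .
  qed
  have "A = topspace T - (\<Union>i. B i - B' i)"
    using assms B(3) by (auto simp: Pi0_iff)
  also have "\<dots> = topspace T \<inter> (\<Inter>p. ?H (fst p) (snd p))"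
  proof -
    have "B' i \<subseteq> topspace T" for i using is_Sigma0_subset[OF B(2)] .
    moreover have "V' i k \<subseteq> topspace T" for i k using openin_subset[OF V(2)] .
    ultimately have "topspace T - (V i k - V' i k - B' i) = topspace T \<inter> ?H i k" for i k by blast
    moreover have "topspace T - (\<Union>i. B i - B' i) = topspace T \<inter> (\<Inter>p. topspace T - (V (fst p) (snd p) - V' (fst p) (snd p) - B' (fst p)))"
      unfolding V(3) by auto blast
    ultimately show ?thesis by auto
  qed
  also have "(\<Inter>p. ?H (fst p) (snd p)) = (\<Inter>n. ?H (fst (h n)) (snd (h n)))"
  proof -
    have "range h = UNIV" unfolding h_def by (rule surj_prod_decode)
    then have "(\<Inter>p. ?H (fst p) (snd p)) = (\<Inter>p\<in>range h. ?H (fst p) (snd p))" by simp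
    then show ?thesis by (simp only: image_image)
  qed
  also have "\<dots> = (\<Inter>n. \<Union>j. ?U n j - ?U' n j)" unfolding S ..
  finally show ?thesis using V W by (intro exI[of _ ?U] exI[of _ ?U'] conjI) auto
qed

section \<open>Locally closed subsets\<close>

lemma locally_closedin_subtopology:
  assumes "A \<subseteq> topspace T"
  shows "locally_closedin (subtopology T A) S \<longleftrightarrow>
    (\<exists>U U'. openin T U \<and> openin T U' \<and> S = (U - U') \<inter> A)"
proof
  assume "locally_closedin (subtopology T A) S"
  then obtain U C where "openin T U" "closedin T C" "S = (U \<inter> A) \<inter> (C \<inter> A)"
    unfolding locally_closedin_def openin_subtopology closedin_subtopology by auto
  then show "\<exists>U U'. openin T U \<and> openin T U' \<and> S = (U - U') \<inter> A"
    using assms by (intro exI[of _ U] exI[of _ "topspace T - C"]) (auto simp: closedin_def)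
next
  assume "\<exists>U U'. openin T U \<and> openin T U' \<and> S = (U - U') \<inter> A"
  then obtain U U' where *: "openin T U" "openin T U'" "S = (U - U') \<inter> A" by auto
  then have "openin (subtopology T A) (U \<inter> A)" "closedin (subtopology T A) ((topspace T - U') \<inter> A)"
    by (auto simp: openin_subtopology closedin_subtopology)
  moreover have "S = (U \<inter> A) \<inter> ((topspace T - U') \<inter> A)" using * assms by auto
  ultimately show "locally_closedin (subtopology T A) S" unfolding locally_closedin_def by blast
qed

lemma locally_closedin_imp_Delta0_2:
  assumes "locally_closedin T S" shows "S \<in> Delta0 2 T"
proof -
  obtain U C where *: "openin T U" "closedin T C" "S = U \<inter> C"
    using assms unfolding locally_closedin_def by auto
  have C: "openin T (topspace T - C)" using * by auto
  have "S = U - (topspace T - C)" using * openin_subset by blast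
  then have "is_Sigma0 T 2 S" using is_Sigma0_2_diff_open[OF *(1) C] by simp
  moreover have "topspace T - S = (topspace T - U) \<union> ((topspace T - C) - {})" using * by auto
  then have "is_Sigma0 T 2 (topspace T - S)"
    using is_Sigma0_Un[of 2 T] is_Sigma0_2_diff_open[OF openin_topspace *(1)]
      is_Sigma0_2_diff_open[OF C openin_empty] by simp
  moreover have "S \<subseteq> topspace T" using * openin_subset by blast
  ultimately show ?thesis by (auto simp: Delta0_def Sigma0_def Pi0_iff)
qed

section \<open>Baire category in the Scott topology\<close>

text \<open>Membership in a Scott open set is decided by finitely much positive information. This is
  inherited by unions, and by intersections on joining the two finite sets.\<close>

lemma scott_open_finite:
  assumes "openin scott_Pomega U" "a \<in> U"
  shows "\<exists>F. finite F \<and> F \<subseteq> a \<and> (\<forall>b. F \<subseteq> b \<longrightarrow> b \<in> U)"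
proof -
  have "generate_topology_on {{A. F \<subseteq> A} | F. finite F} U"
    using assms(1) by (simp add: scott_Pomega_def openin_topology_generated_by_iff)
  then show ?thesis using assms(2)
  proof (induction arbitrary: a)
    case (Int V W)
    obtain F where "finite F" "F \<subseteq> a" "\<forall>b. F \<subseteq> b \<longrightarrow> b \<in> V" using Int.IH(1)[of a] Int.prems by auto
    moreover obtain G where "finite G" "G \<subseteq> a" "\<forall>b. G \<subseteq> b \<longrightarrow> b \<in> W"
      using Int.IH(2)[of a] Int.prems by auto
    ultimately show ?case by (intro exI[of _ "F \<union> G"]) simp
  next
    case (UN K)
    then obtain V where V: "V \<in> K" "a \<in> V" by auto
    obtain F where "finite F" "F \<subseteq> a" "\<forall>b. F \<subseteq> b \<longrightarrow> b \<in> V" using UN.IH[OF V] by auto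
    then show ?case using V(1) by (intro exI[of _ F]) auto
  next
    case (Basis s)
    then show ?case by auto
  qed simp
qed

lemma openin_scott_basic: "finite F \<Longrightarrow> openin scott_Pomega {b. F \<subseteq> b}"
  unfolding scott_Pomega_def openin_topology_generated_by_iff
  by (rule generate_topology_on.Basis) auto

lemma topspace_scott: "topspace scott_Pomega = UNIV"
  using openin_subset[OF openin_scott_basic[of "{}"]] by auto

text \<open>Otherwise locally closed sets meeting \<open>B\<close> can be shrunk step by step,
  avoiding the points of \<open>Z\<close> one after another while entering each set of the
  intersection. The limit would then be a point of \<open>Z\<close> different from all points of
  \<open>Z\<close>.\<close>

lemma scott_countable_imp_isolated:
  fixes V V' :: "nat \<Rightarrow> nat \<Rightarrow> nat set set"
  assumes Z: "countable Z" "(\<Inter>i. \<Union>j. V i j - V' i j) \<subseteq> Z" and B: "B \<subseteq> (\<Inter>i. \<Union>j. V i j - V' i j)" "B \<noteq> {}"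
    and V: "\<And>i j. openin scott_Pomega (V i j)" "\<And>i j. openin scott_Pomega (V' i j)"
  obtains b U U' where "openin scott_Pomega U" "openin scott_Pomega U'" "b \<in> B" "(U - U') \<inter> B = {b}"
proof (rule ccontr)
  assume "\<not> thesis"
  with that have crowded: "\<And>U U' b. \<lbrakk>openin scott_Pomega U; openin scott_Pomega U'; b \<in> B\<rbrakk>
      \<Longrightarrow> (U - U') \<inter> B \<noteq> {b}" by blast
  define x where "x = from_nat_into Z"
  \<comment> \<open>A pair \<open>(F, K)\<close> stands for the locally closed set \<open>{z. F \<subseteq> z} - K\<close>. Since \<open>- K\<close> is closed under
    directed unions, the union of the first components lies in all the sets of a descending sequence.\<close>
  define P where "P s \<longleftrightarrow> finite (fst s) \<and> openin scott_Pomega (snd s) \<and> (\<exists>a\<in>B. fst s \<subseteq> a \<and> a \<notin> snd s)"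
    for s :: "nat set \<times> nat set set"
  \<comment> \<open>The last clause ranges over all \<open>z\<close> in the set of \<open>t\<close>,
    not only over points of \<open>B\<close>, because the limit need not lie in
    \<open>B\<close>.\<close>
  define Q where "Q i s t \<longleftrightarrow> fst s \<subseteq> fst t \<and> snd s \<subseteq> snd t \<and>
      (\<forall>z. fst t \<subseteq> z \<and> z \<notin> snd t \<longrightarrow> z \<noteq> x i \<and> z \<in> (\<Union>j. V i j - V' i j))"
    for i and s t :: "nat set \<times> nat set set"
  have step: "\<exists>t. P t \<and> Q i s t" if "P s" for s i
  proof -
    obtain F K where s: "s = (F, K)" by fastforce
    have F: "finite F" "openin scott_Pomega K" and "\<exists>b\<in>B. F \<subseteq> b \<and> b \<notin> K"
      using that by (simp_all add: P_def s)
    then obtain b where b: "b \<in> B" "F \<subseteq> b" "b \<notin> K" by blast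
    \<comment> \<open>Besides \<open>b\<close> the set contains a second point of \<open>B\<close>,
      so at least one of the two differs from \<open>x i\<close>.\<close>
    have "({c. F \<subseteq> c} - K) \<inter> B \<noteq> {b}" using crowded[OF openin_scott_basic[OF F(1)] F(2) b(1)] .
    then obtain a where a: "a \<in> B" "F \<subseteq> a" "a \<notin> K" "a \<noteq> x i"
      using b by (cases "b = x i") auto
    obtain j where j: "a \<in> V i j" "a \<notin> V' i j" using a(1) B by blast
    obtain G where G: "finite G" "G \<subseteq> a" "\<And>c. G \<subseteq> c \<Longrightarrow> c \<in> V i j"
      using scott_open_finite[OF V(1) j(1)] by auto
    \<comment> \<open>Some \<open>n\<close> separates \<open>a\<close> from \<open>x i\<close>. If
      \<open>n \<in> a\<close>, it joins the finite part; otherwise the open set of all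
      \<open>c\<close> containing \<open>n\<close> is removed.\<close>
    consider n where "n \<in> a" "n \<notin> x i" | n where "n \<notin> a" "n \<in> x i" using a(4) by blast
    then show ?thesis
    proof cases
      case 1
      let ?t = "(insert n (F \<union> G), K \<union> V' i j)"
      have "P ?t" unfolding P_def using F a j G 1 V by (auto intro!: bexI[of _ a])
      moreover have "Q i s ?t" unfolding Q_def s using G 1 by auto
      ultimately show ?thesis by blast
    next
      case 2
      let ?t = "(F \<union> G, K \<union> V' i j \<union> {c. n \<in> c})"
      have "openin scott_Pomega {c. n \<in> c}" using openin_scott_basic[of "{n}"] by simp
      then have "P ?t" unfolding P_def using F a j G 2 V
        by (auto intro!: bexI[of _ a] openin_Un)
      moreover have "Q i s ?t" unfolding Q_def s using G 2 by auto
      ultimately show ?thesis by blast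
    qed
  qed
  have "\<exists>s. P s" using B(2) by (intro exI[of _ "({}, {})"]) (auto simp: P_def)
  then obtain s where s: "\<And>n. P (s n)" "\<And>n. Q n (s n) (s (Suc n))"
    using dependent_nat_choice[of "\<lambda>_. P" Q] step by metis
  define z where "z = (\<Union>n. fst (s n))"
  have mono: "fst (s m) \<subseteq> fst (s n)" "snd (s m) \<subseteq> snd (s n)" if "m \<le> n" for m n
    using lift_Suc_mono_le[of "\<lambda>n. fst (s n)", OF _ that] lift_Suc_mono_le[of "\<lambda>n. snd (s n)", OF _ that]
      s(2) unfolding Q_def by auto
  have fin: "\<exists>m. G \<subseteq> fst (s m)" if "finite G" "G \<subseteq> z" for G
    using that
  proof (induction rule: finite_induct)
    case (insert g G)
    then obtain m k where "G \<subseteq> fst (s m)" "g \<in> fst (s k)" by (auto simp: z_def)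
    then show ?case using mono(1)[of m "max m k"] mono(1)[of k "max m k"]
      by (intro exI[of _ "max m k"]) auto
  qed simp
  \<comment> \<open>If \<open>z\<close> were in this open set, a finite part of \<open>z\<close>,
    present at some stage \<open>m\<close>, would force membership. The witness in \<open>B\<close>
    at stage \<open>max m n\<close> contains that part and yet avoids the set.\<close>
  have zK: "z \<notin> snd (s n)" for n
  proof
    assume z: "z \<in> snd (s n)"
    have "openin scott_Pomega (snd (s n))" using s(1)[of n] by (simp add: P_def)
    then obtain G where G: "finite G" "G \<subseteq> z" "\<And>c. G \<subseteq> c \<Longrightarrow> c \<in> snd (s n)"
      using scott_open_finite[OF _ z] by auto
    obtain m where m: "G \<subseteq> fst (s m)" using fin[OF G(1,2)] by blast
    obtain a where "fst (s (max m n)) \<subseteq> a" "a \<notin> snd (s (max m n))"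
      using s(1)[of "max m n"] unfolding P_def by auto
    then show False using G(3)[of a] m mono(1)[of m "max m n"] mono(2)[of n "max m n"] by auto
  qed
  have "fst (s n) \<subseteq> z" for n unfolding z_def by auto
  then have z: "z \<noteq> x n" "z \<in> (\<Union>j. V n j - V' n j)" for n
    using s(2)[of n] zK unfolding Q_def by auto
  then have "z \<in> Z" using Z by blast
  then obtain n where "z = x n" unfolding x_def using from_nat_into_surj[OF Z(1)] by metis
  then show False using z by blast
qed

section \<open>Passage from P(omega) to quasi-Polish spaces\<close>

text \<open>Preimages of the sets of all \<open>b\<close> containing \<open>n\<close> under the
  embedding. A countable family witnessing \<open>T\<^sub>0\<close> makes complements of points
  \<open>\<Sigma>\<^sup>0\<^sub>2\<close> and cuts finite sets down to points.\<close>

lemma quasi_Polish_separating: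
  assumes "quasi_Polish Y"
  shows "\<exists>G. (\<forall>n::nat. openin Y (G n)) \<and>
    (\<forall>x\<in>topspace Y. \<forall>y\<in>topspace Y. x \<noteq> y \<longrightarrow> (\<exists>n. (x \<in> G n) \<noteq> (y \<in> G n)))"
proof -
  have "\<exists>S\<in>Pi0 2 scott_Pomega. \<exists>e. homeomorphic_map Y (subtopology scott_Pomega S) e"
    using assms by (simp add: quasi_Polish_def homeomorphic_space)
  then obtain S and e :: "'a \<Rightarrow> nat set" where e: "homeomorphic_map Y (subtopology scott_Pomega S) e"
    by (elim bexE exE)
  have c: "continuous_map Y scott_Pomega e"
    using homeomorphic_imp_continuous_map[OF e] by (simp add: continuous_map_in_subtopology)
  have inj: "inj_on e (topspace Y)" using homeomorphic_imp_injective_map[OF e] .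
  let ?G = "\<lambda>n. {y \<in> topspace Y. e y \<in> {b. {n} \<subseteq> b}}"
  have "openin Y (?G n)" for n
    by (rule openin_continuous_map_preimage[OF c openin_scott_basic]) simp
  moreover have "\<exists>n. (x \<in> ?G n) \<noteq> (y \<in> ?G n)"
    if "x \<in> topspace Y" "y \<in> topspace Y" "x \<noteq> y" for x y
  proof -
    have "e x \<noteq> e y" using inj_onD[OF inj _ that(1,2)] that(3) by blast
    then obtain n where "(n \<in> e x) \<noteq> (n \<in> e y)" by blast
    then show ?thesis using that by (intro exI[of _ n]) simp
  qed
  ultimately show ?thesis by (intro exI[of _ ?G] conjI allI ballI impI)
qed

text \<open>The image of \<open>X\<close> in P(omega) is a countable intersection of countable
  unions of differences of Scott open sets, so the Baire argument isolates a point of the image of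
  \<open>A\<close>, and the isolating set is pulled back.\<close>

lemma Pi0_3_countable_imp_locally_closed_point:
  assumes "quasi_Polish Y" "X \<in> Pi0 3 Y" "countable X" "A \<subseteq> X" "A \<noteq> {}"
  shows "\<exists>x\<in>A. locally_closedin (subtopology Y A) {x}"
proof -
  have "\<exists>S\<in>Pi0 2 scott_Pomega. \<exists>e. homeomorphic_map Y (subtopology scott_Pomega S) e"
    using assms(1) by (simp add: quasi_Polish_def homeomorphic_space)
  then obtain S and e :: "'a \<Rightarrow> nat set" where S: "S \<in> Pi0 2 scott_Pomega" and
    e: "homeomorphic_map Y (subtopology scott_Pomega S) e"
    by (elim bexE exE)
  have c: "continuous_map Y scott_Pomega e"
    using homeomorphic_imp_continuous_map[OF e] by (simp add: continuous_map_in_subtopology)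
  have inj: "inj_on e (topspace Y)" using homeomorphic_imp_injective_map[OF e] .
  have im: "e ` topspace Y = S"
    using homeomorphic_imp_surjective_map[OF e] by (simp add: topspace_scott)
  define pre where "pre W = {y \<in> topspace Y. e y \<in> W}" for W
  \<comment> \<open>Since \<open>e\<close> is injective and open onto \<open>S\<close>, every open
    set of \<open>Y\<close> is the preimage of a Scott open set.\<close>
  have opn: "\<exists>W. openin scott_Pomega W \<and> U = pre W" if U: "openin Y U" for U
  proof -
    have "openin (subtopology scott_Pomega S) (e ` U)"
      using homeomorphic_imp_open_map[OF e] U by (simp add: open_map_def)
    then obtain W where W: "openin scott_Pomega W" "e ` U = W \<inter> S" by (auto simp: openin_subtopology)
    have "y \<in> U \<longleftrightarrow> e y \<in> W" if "y \<in> topspace Y" for y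
    proof -
      have "y \<in> U \<longleftrightarrow> e y \<in> e ` U"
        using inj_on_image_mem_iff[OF inj that openin_subset[OF U]] by simp
      moreover have "e y \<in> S" using im that by blast
      ultimately show ?thesis using W(2) by simp
    qed
    then have "U = pre W" using openin_subset[OF U] by (auto simp: pre_def)
    then show ?thesis using W(1) by auto
  qed
  obtain U U' where U: "\<forall>i j::nat. openin Y (U i j) \<and> openin Y (U' i j)"
    and X: "X = topspace Y \<inter> (\<Inter>i::nat. \<Union>j. U i j - U' i j)"
    using Pi0_3_eq_INT[OF assms(2)] by (elim exE conjE)
  obtain R R' where R: "\<forall>i j::nat. openin scott_Pomega (R i j) \<and> openin scott_Pomega (R' i j)"
    and S_eq: "S = topspace scott_Pomega \<inter> (\<Inter>i::nat. \<Union>j. R i j - R' i j)"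
    using Pi0_2_eq_INT[OF S] by (elim exE conjE)
  obtain W where W: "\<And>i j. openin scott_Pomega (W i j)" "\<And>i j. U i j = pre (W i j)"
  proof -
    have "\<forall>i j. \<exists>W. openin scott_Pomega W \<and> U i j = pre W" using opn U by simp
    then show thesis using that by metis
  qed
  obtain W' where W': "\<And>i j. openin scott_Pomega (W' i j)" "\<And>i j. U' i j = pre (W' i j)"
  proof -
    have "\<forall>i j. \<exists>W. openin scott_Pomega W \<and> U' i j = pre W" using opn U by simp
    then show thesis using that by metis
  qed
  \<comment> \<open>The conditions defining \<open>S\<close> and those defining \<open>X\<close>
    inside \<open>Y\<close> are interleaved at even and odd indices.\<close>
  let ?V = "\<lambda>i. if even i then R (i div 2) else W (i div 2)"
  let ?V' = "\<lambda>i. if even i then R' (i div 2) else W' (i div 2)"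
  have nat: "(UNIV::nat set) = range (\<lambda>i. 2 * i) \<union> range (\<lambda>i. 2 * i + 1)"
    by (auto simp: image_iff) presburger
  have "(\<Inter>i. \<Union>j. ?V i j - ?V' i j) =
      (\<Inter>i\<in>range (\<lambda>i. 2 * i) \<union> range (\<lambda>i. 2 * i + 1). \<Union>j. ?V i j - ?V' i j)"
    using nat by simp
  also have "\<dots> = S \<inter> (\<Inter>i. \<Union>j. W i j - W' i j)" by (simp add: INT_Un S_eq topspace_scott)
  also have "\<dots> = e ` X"
  proof -
    have "y \<in> U i j - U' i j \<longleftrightarrow> e y \<in> W i j - W' i j" if "y \<in> topspace Y" for y i j
      using that by (simp add: W(2) W'(2) pre_def)
    then have "X = {y \<in> topspace Y. e y \<in> (\<Inter>i. \<Union>j. W i j - W' i j)}" unfolding X by blast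
    then show ?thesis using im by blast
  qed
  finally have eq: "(\<Inter>i. \<Union>j. ?V i j - ?V' i j) = e ` X" .
  obtain b N N' where N: "openin scott_Pomega N" "openin scott_Pomega N'" "b \<in> e ` A" "(N - N') \<inter> e ` A = {b}"
    by (rule scott_countable_imp_isolated[of "e ` X" ?V ?V' "e ` A"])
      (use eq assms R W W' in auto)
  then obtain x where x: "x \<in> A" "b = e x" by auto
  have AY: "A \<subseteq> topspace Y" using assms(4) X by auto
  have "{x} = ({y \<in> topspace Y. e y \<in> N} - {y \<in> topspace Y. e y \<in> N'}) \<inter> A"
  proof -
    have iff: "e y \<in> N - N' \<longleftrightarrow> y = x" if "y \<in> A" for y
    proof -
      have "e y \<in> N - N' \<longleftrightarrow> e y = e x" using N(4) that x(2) by blast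
      also have "\<dots> \<longleftrightarrow> y = x" using inj_on_eq_iff[OF inj] AY that x(1) by blast
      finally show ?thesis .
    qed
    show ?thesis
    proof (intro set_eqI)
      fix y
      show "y \<in> {x} \<longleftrightarrow> y \<in> ({y \<in> topspace Y. e y \<in> N} - {y \<in> topspace Y. e y \<in> N'}) \<inter> A"
        using iff[of y] x(1) AY by auto
    qed
  qed
  moreover have "openin Y {y \<in> topspace Y. e y \<in> N}" "openin Y {y \<in> topspace Y. e y \<in> N'}"
    using openin_continuous_map_preimage[OF c] N by blast+
  ultimately show ?thesis using x(1) unfolding locally_closedin_subtopology[OF AY] by blast
qed

section \<open>From locally closed points to \<open>Delta0 3\<close>\<close>

text \<open>Every other point is told apart from \<open>x\<close> by some \<open>G n\<close>; that
  side of \<open>G n\<close> which misses \<open>x\<close> is a difference of open sets.\<close>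

lemma is_Sigma0_2_compl_singleton:
  assumes G: "\<And>n::nat. openin Y (G n)"
    "\<And>x y. \<lbrakk>x \<in> topspace Y; y \<in> topspace Y; x \<noteq> y\<rbrakk> \<Longrightarrow> \<exists>n. (x \<in> G n) \<noteq> (y \<in> G n)"
    and x: "x \<in> topspace Y"
  shows "is_Sigma0 Y 2 (topspace Y - {x})"
proof -
  have "is_Sigma0 Y 2 (\<Union>n. if x \<in> G n then topspace Y - G n else G n - {})"
    by (rule is_Sigma0_UN) (auto simp: G is_Sigma0_2_diff_open simp del: Diff_empty)
  moreover have "(\<Union>n. if x \<in> G n then topspace Y - G n else G n - {}) = topspace Y - {x}"
    using G(2)[OF x] openin_subset[OF G(1)] by (auto split: if_splits) (metis DiffI)
  ultimately show ?thesis by simp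
qed

lemma locally_closed_points_imp_Delta0_3:
  assumes G: "\<And>n::nat. openin Y (G n)"
    "\<And>x y. \<lbrakk>x \<in> topspace Y; y \<in> topspace Y; x \<noteq> y\<rbrakk> \<Longrightarrow> \<exists>n. (x \<in> G n) \<noteq> (y \<in> G n)"
    and X: "X \<subseteq> topspace Y" "countable X"
    and lc: "\<And>A. A \<subseteq> X \<Longrightarrow> A \<noteq> {} \<Longrightarrow> \<exists>x\<in>A. locally_closedin (subtopology Y A) {x}"
  shows "X \<in> Delta0 3 Y"
proof -
  note compl = is_Sigma0_2_compl_singleton[OF G]
  have Y2: "is_Sigma0 Y 2 (topspace Y)" using is_Sigma0_mono[of Y 1] opens[of Y "topspace Y"] by simp
  have "is_Sigma0 Y 3 (\<Union>x\<in>X. topspace Y - (topspace Y - {x}))"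
    by (rule is_Sigma0_UN_diff[where \<beta> = "\<lambda>_. 2"]) (use X Y2 compl in auto)
  moreover have "(\<Union>x\<in>X. topspace Y - (topspace Y - {x})) = X" using X by auto
  ultimately have S: "is_Sigma0 Y 3 X" by simp
  \<comment> \<open>Once \<open>P = X\<close> is reached, the complement of \<open>X\<close> is
    \<open>(topspace Y - W) \<union> (W - X)\<close>, a union of two
    \<open>\<Sigma>\<^sup>0\<^sub>3\<close> sets. The largest good set replaces a transfinite
    recursion that collects locally closed points.\<close>
  define good where "good P \<longleftrightarrow> (\<exists>W. is_Sigma0 Y 2 W \<and> W \<inter> X = P \<and> is_Sigma0 Y 3 (W - P))" for P
  have good_UN: "good (\<Union>i\<in>I. P i)" if I: "countable I" "\<And>i. i \<in> I \<Longrightarrow> good (P i)"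
    for I :: "'a set" and P
  proof -
    obtain W where W: "\<And>i. i \<in> I \<Longrightarrow> is_Sigma0 Y 2 (W i) \<and> W i \<inter> X = P i \<and> is_Sigma0 Y 3 (W i - P i)"
      using I(2) unfolding good_def by metis
    have "is_Sigma0 Y 2 (\<Union>i\<in>I. W i)" "is_Sigma0 Y 3 (\<Union>i\<in>I. W i - P i)"
      by (intro is_Sigma0_UN I(1); simp add: W)+
    moreover have "(\<Union>i\<in>I. W i) \<inter> X = (\<Union>i\<in>I. P i)" using W by auto
    \<comment> \<open>A point of \<open>W i - P i\<close> lies outside \<open>X\<close>, hence
      outside every \<open>P j\<close>.\<close>
    moreover have "(\<Union>i\<in>I. W i) - (\<Union>i\<in>I. P i) = (\<Union>i\<in>I. W i - P i)" using W by blast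
    ultimately show ?thesis unfolding good_def by metis
  qed
  define M where "M = \<Union>{P. good P}"
  have "M \<subseteq> X" unfolding M_def good_def by auto
  \<comment> \<open>There may be uncountably many good sets, but one for each point of the countable
    set \<open>M\<close> suffices to cover \<open>M\<close>.\<close>
  have "\<forall>x\<in>M. \<exists>P. good P \<and> x \<in> P" unfolding M_def by auto
  then obtain P where P: "\<And>x. x \<in> M \<Longrightarrow> good (P x) \<and> x \<in> P x" by metis
  have "(\<Union>x\<in>M. P x) = M" using P unfolding M_def by blast
  moreover have "countable M" using X(2) \<open>M \<subseteq> X\<close> countable_subset by blast
  ultimately have "good M" using good_UN[of M P] P by simp
  then obtain W where W: "is_Sigma0 Y 2 W" "W \<inter> X = M" "is_Sigma0 Y 3 (W - M)" unfolding good_def by auto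
  have "M = X"
  proof (rule ccontr)
    assume "M \<noteq> X"
    then have ne: "X - M \<noteq> {}" "X - M \<subseteq> X" using \<open>M \<subseteq> X\<close> by auto
    have XM: "X - M \<subseteq> topspace Y" using X by auto
    obtain x U U' where x: "x \<in> X - M" "openin Y U" "openin Y U'" "{x} = (U - U') \<inter> (X - M)"
      using lc[OF ne(2,1)] unfolding locally_closedin_subtopology[OF XM] by auto
    let ?W = "W \<union> (U - U')"
    have "is_Sigma0 Y 2 ?W" by (intro is_Sigma0_Un is_Sigma0_2_diff_open W(1) x(2,3)) simp
    moreover have "?W \<inter> X = insert x M" using W(2) x by blast
    moreover have "is_Sigma0 Y 3 (?W - insert x M)"
    proof -
      have "is_Sigma0 Y 2 ((topspace Y - {x}) \<inter> (U - U'))"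
        using is_Sigma0_2_Int_diff_open compl x X by blast
      then have "is_Sigma0 Y 3 ((topspace Y - {x}) \<inter> (U - U') - W)"
        by (intro is_Sigma0_diff[of 2] W(1)) simp_all
      then have "is_Sigma0 Y 3 ((W - M) \<union> ((topspace Y - {x}) \<inter> (U - U') - W))"
        by (intro is_Sigma0_Un W(3)) simp_all
      moreover have "(W - M) \<union> ((topspace Y - {x}) \<inter> (U - U') - W) = ?W - insert x M"
        \<comment> \<open>The points gained from \<open>U - U'\<close>, other than \<open>x\<close>,
          lie outside \<open>X\<close> unless they are in \<open>M\<close>, hence already in
          \<open>W\<close>.\<close>
        using W(2) x openin_subset[OF x(2)] by blast
      ultimately show ?thesis by simp
    qed
    ultimately have "good (insert x M)" unfolding good_def by blast
    then show False using x(1) unfolding M_def by blast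
  qed
  moreover have "is_Sigma0 Y 3 (topspace Y - W)" by (intro is_Sigma0_diff[of 2] W(1) Y2) simp_all
  ultimately have "is_Sigma0 Y 3 ((topspace Y - W) \<union> (W - X))"
    using W(3) \<open>M = X\<close> by (intro is_Sigma0_Un) simp_all
  moreover have "(topspace Y - W) \<union> (W - X) = topspace Y - X"
    using W(2) \<open>M = X\<close> is_Sigma0_subset[OF W(1)] by blast
  ultimately show ?thesis using S X by (simp add: Delta0_def Sigma0_def Pi0_iff)
qed

section \<open>Conditions (2) and (3)\<close>

text \<open>One of the differences that make up \<open>F\<close> is non-empty, which gives a finite
  non-empty locally closed set. One of least cardinality is a singleton, since a separating
  \<open>G n\<close> would cut out a smaller one.\<close>

lemma finite_Delta0_2_imp_locally_closed_point:
  assumes G: "\<And>n::nat. openin Y (G n)"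
    "\<And>x y. \<lbrakk>x \<in> topspace Y; y \<in> topspace Y; x \<noteq> y\<rbrakk> \<Longrightarrow> \<exists>n. (x \<in> G n) \<noteq> (y \<in> G n)"
    and A: "A \<subseteq> topspace Y"
    and F: "finite F" "F \<noteq> {}" "F \<in> Delta0 2 (subtopology Y A)"
  shows "\<exists>x\<in>A. locally_closedin (subtopology Y A) {x}"
proof -
  define Q where "Q L \<longleftrightarrow> finite L \<and> L \<noteq> {} \<and> (\<exists>U U'. openin Y U \<and> openin Y U' \<and> L = (U - U') \<inter> A)" for L
  have "is_Sigma0 (subtopology Y A) 2 F" using F(3) by (simp add: Delta0_def Sigma0_def)
  from is_Sigma0_2_imp_UN_diff_open[OF this]
  obtain U U' where U: "\<forall>i::nat. openin (subtopology Y A) (U i) \<and> openin (subtopology Y A) (U' i)"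
    "F = (\<Union>i. U i - U' i)" by auto
  then obtain i where i: "U i - U' i \<noteq> {}" using F(2) by blast
  obtain V V' where V: "openin Y V" "openin Y V'" "U i = V \<inter> A" "U' i = V' \<inter> A"
    using U(1)[rule_format, of i] by (auto simp: openin_subtopology)
  have "U i - U' i = (V - V') \<inter> A" using V by auto
  moreover have "finite (U i - U' i)" using F(1) U(2) by (meson UN_upper UNIV_I finite_subset)
  ultimately have "Q (U i - U' i)" using V i unfolding Q_def by blast
  then obtain L where L: "Q L" "\<And>K. Q K \<Longrightarrow> card L \<le> card K"
    using ex_has_least_nat[of Q _ card] by blast
  then obtain O1 O2 where O: "openin Y O1" "openin Y O2" "L = (O1 - O2) \<inter> A" unfolding Q_def by auto
  obtain x where x: "x \<in> L" using L unfolding Q_def by auto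
  have "L = {x}"
  proof (rule ccontr)
    assume "L \<noteq> {x}"
    then obtain y where y: "y \<in> L" "y \<noteq> x" using x by auto
    then obtain n where n: "(x \<in> G n) \<noteq> (y \<in> G n)" using G(2)[of x y] x O A by auto
    have fin: "finite L" using L by (simp add: Q_def)
    have "L \<inter> G n = (O1 \<inter> G n - O2) \<inter> A" "L \<inter> G n \<noteq> {}" "openin Y (O1 \<inter> G n)"
      using O x y n G(1) by auto
    then have "Q (L \<inter> G n)" unfolding Q_def using O fin by blast
    moreover have "L \<inter> G n \<subset> L" using n x y by auto
    ultimately show False using L(2) psubset_card_mono[OF fin] leD by blast
  qed
  then have "locally_closedin (subtopology Y A) {x}"
    unfolding locally_closedin_subtopology[OF A] using O by blast
  then show ?thesis using x O by blast
qed

text \<open>\<open>A\<close> is dense in its closure \<open>A'\<close> for the finer topology, so a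
  locally closed point of \<open>A'\<close> is isolated there and must belong to
  \<open>A\<close>.\<close>

lemma Pi0_2_locally_closed_points_imp_all:
  assumes X: "X \<subseteq> topspace Y" "countable X"
    and lc: "\<And>A. A \<in> Pi0 2 (subtopology Y X) \<Longrightarrow> A \<noteq> {} \<Longrightarrow>
      \<exists>x\<in>A. locally_closedin (subtopology Y A) {x}"
    and A: "A \<subseteq> X" "A \<noteq> {}"
  shows "\<exists>x\<in>A. locally_closedin (subtopology Y A) {x}"
proof -
  \<comment> \<open>the closure of \<open>A\<close> in \<open>X\<close> for the topology generated by the open and the closed sets\<close>
  define A' where "A' = {x \<in> X. \<forall>U U'. openin Y U \<and> openin Y U' \<and> x \<in> U - U' \<longrightarrow> (U - U') \<inter> A \<noteq> {}}"
  have sub: "A \<subseteq> A'" "A' \<subseteq> X" using A unfolding A'_def by auto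
  have "\<forall>x\<in>X - A'. \<exists>U U'. openin Y U \<and> openin Y U' \<and> x \<in> U - U' \<and> (U - U') \<inter> A = {}"
    unfolding A'_def by auto
  then obtain U U' where U: "\<And>x. x \<in> X - A' \<Longrightarrow> openin Y (U x) \<and> openin Y (U' x) \<and>
      x \<in> U x - U' x \<and> (U x - U' x) \<inter> A = {}" by metis
  \<comment> \<open>One separating pair for each point of \<open>X - A'\<close> is enough, and
    \<open>X\<close> is countable; this is what makes \<open>A'\<close> a \<open>Pi0 2\<close>
    set.\<close>
  have "is_Sigma0 (subtopology Y X) 2 (\<Union>x\<in>X - A'. U x \<inter> X - U' x \<inter> X)"
    by (rule is_Sigma0_UN) (use X U in \<open>auto intro!: is_Sigma0_2_diff_open openin_subtopology_Int\<close>)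
  moreover have "(\<Union>x\<in>X - A'. U x \<inter> X - U' x \<inter> X) = topspace (subtopology Y X) - A'"
  proof -
    have "y \<notin> A'" if "x \<in> X - A'" "y \<in> U x - U' x" for x y
      using U[OF that(1)] that(2) unfolding A'_def by blast
    moreover have "topspace (subtopology Y X) = X" using X by auto
    ultimately show ?thesis using U by blast
  qed
  ultimately have "A' \<in> Pi0 2 (subtopology Y X)" using sub X by (simp add: Pi0_iff Int_absorb1)
  then obtain x where x: "x \<in> A'" "locally_closedin (subtopology Y A') {x}" using lc A sub by blast
  have AY: "A' \<subseteq> topspace Y" "A \<subseteq> topspace Y" using sub X by auto
  obtain V V' where V: "openin Y V" "openin Y V'" "{x} = (V - V') \<inter> A'"
    using x(2) unfolding locally_closedin_subtopology[OF AY(1)] by auto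
  have "x \<in> V - V'" using V(3) by auto
  then have "(V - V') \<inter> A \<noteq> {}" using x(1) V unfolding A'_def by blast
  then obtain y where y: "y \<in> V - V'" "y \<in> A" by auto
  have "y \<in> {x}" unfolding V(3) using y sub by auto
  then have "x \<in> A" using y by simp
  moreover have "{x} = (V - V') \<inter> A"
  proof
    show "{x} \<subseteq> (V - V') \<inter> A" using \<open>x \<in> V - V'\<close> \<open>x \<in> A\<close> by simp
    show "(V - V') \<inter> A \<subseteq> {x}" unfolding V(3) using sub by blast
  qed
  ultimately show ?thesis unfolding locally_closedin_subtopology[OF AY(2)] using V by blast
qed

theorem theorem5p6:
  fixes Y :: "'a topology" and X :: "'a set"
  assumes "quasi_Polish Y" and "X \<subseteq> topspace Y" and "countable X"
  shows "(X \<in> Delta0 3 Y \<longleftrightarrow>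
           (\<forall>A \<in> Pi0 2 (subtopology Y X). A \<noteq> {} \<longrightarrow>
              (\<exists>F. finite F \<and> F \<noteq> {} \<and> F \<subseteq> A \<and> F \<in> Delta0 2 (subtopology Y A))))
       \<and> ((\<forall>A \<in> Pi0 2 (subtopology Y X). A \<noteq> {} \<longrightarrow>
              (\<exists>F. finite F \<and> F \<noteq> {} \<and> F \<subseteq> A \<and> F \<in> Delta0 2 (subtopology Y A))) \<longleftrightarrow>
           (\<forall>A. A \<subseteq> X \<and> A \<noteq> {} \<longrightarrow> (\<exists>x \<in> A. locally_closedin (subtopology Y A) {x})))"
proof -
  obtain G where G: "\<And>n::nat. openin Y (G n)"
    "\<And>x y. \<lbrakk>x \<in> topspace Y; y \<in> topspace Y; x \<noteq> y\<rbrakk> \<Longrightarrow> \<exists>n. (x \<in> G n) \<noteq> (y \<in> G n)"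
    using quasi_Polish_separating[OF assms(1)] by blast
  let ?one = "X \<in> Delta0 3 Y"
  let ?two = "\<forall>A \<in> Pi0 2 (subtopology Y X). A \<noteq> {} \<longrightarrow>
    (\<exists>F. finite F \<and> F \<noteq> {} \<and> F \<subseteq> A \<and> F \<in> Delta0 2 (subtopology Y A))"
  let ?three = "\<forall>A. A \<subseteq> X \<and> A \<noteq> {} \<longrightarrow> (\<exists>x \<in> A. locally_closedin (subtopology Y A) {x})"
  have sub: "A \<subseteq> X" if "A \<in> Pi0 2 (subtopology Y X)" for A
    using that by (auto simp: Pi0_iff)
  have "?one \<Longrightarrow> ?three"
    using Pi0_3_countable_imp_locally_closed_point[OF assms(1) _ assms(3)] by (auto simp: Delta0_def)
  moreover have "?three \<Longrightarrow> ?one"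
    using locally_closed_points_imp_Delta0_3[OF G assms(2,3)] by blast
  moreover have "?three \<Longrightarrow> ?two"
  proof (intro ballI impI)
    fix A assume three: ?three and A: "A \<in> Pi0 2 (subtopology Y X)" "A \<noteq> {}"
    then obtain x where "x \<in> A" "locally_closedin (subtopology Y A) {x}" using sub by blast
    then show "\<exists>F. finite F \<and> F \<noteq> {} \<and> F \<subseteq> A \<and> F \<in> Delta0 2 (subtopology Y A)"
      by (intro exI[of _ "{x}"]) (simp add: locally_closedin_imp_Delta0_2)
  qed
  \<comment> \<open>Condition (2) yields locally closed points only in \<open>Pi0 2\<close> subsets
    of \<open>X\<close>; the closure argument extends this to arbitrary subsets.\<close>
  moreover have ?three if two: ?two
  proof (intro allI impI)
    fix A assume A: "A \<subseteq> X \<and> A \<noteq> {}"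
    have pt: "\<exists>x\<in>D. locally_closedin (subtopology Y D) {x}"
      if D: "D \<in> Pi0 2 (subtopology Y X)" "D \<noteq> {}" for D
    proof -
      obtain F where "finite F" "F \<noteq> {}" "F \<in> Delta0 2 (subtopology Y D)" using two D by blast
      moreover have "D \<subseteq> topspace Y" using sub[OF D(1)] assms(2) by blast
      ultimately show ?thesis using finite_Delta0_2_imp_locally_closed_point[OF G] by blast
    qed
    show "\<exists>x\<in>A. locally_closedin (subtopology Y A) {x}"
      using Pi0_2_locally_closed_points_imp_all[OF assms(2,3) pt] A by blast
  qed
  ultimately show ?thesis by blast
qed

end
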